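(* Let $R$ be a commutative Noetherian ring, $M$ a finitely generated projective $R$-module, and $I$ an ideal of $R$. Then $r(I,M)=\widetilde{I}$.
   Context: For submodules $A,B$ of an $R$-module, $(A:B)=\{x\in R : xB\subseteq A\}$. Define $r(I,M)=\bigcup_{k\geq 1}(I^{k+1}M:I^kM)$ and $\widetilde{I}=r(I,R)=\bigcup_{k\geq 1}(I^{k+1}:I^k)$, the Ratliff-Rush closure of $I$ (both are ascending unions of ideals of $R$).
   Formalization: The formal theorem additionally assumes that M is faithful (its annihilator is zero); without this the claim fails, e.g. for R = Z, I = 2Z, M = 0, where r(I,M) = Z but the Ratliff-Rush closure of I is 2Z. *)

theory Defs
  imports "HOL-Algebra.Algebra"
begin

definition submodule_gen ::
  "('a, 'r) ring_scheme \<Rightarrow> ('a, 'm, 'z) module_scheme \<Rightarrow> 'm set \<Rightarrow> 'm set" where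
  "submodule_gen R M S = \<Inter> {H. submodule H R M \<and> S \<subseteq> H}"

definition fin_gen_module ::
  "('a, 'r) ring_scheme \<Rightarrow> ('a, 'm, 'z) module_scheme \<Rightarrow> bool" where
  "fin_gen_module R M \<longleftrightarrow>
     (\<exists>S. finite S \<and> S \<subseteq> carrier M \<and> submodule_gen R M S = carrier M)"

definition module_hom ::
  "('a, 'r) ring_scheme \<Rightarrow> ('a, 'm, 'y) module_scheme \<Rightarrow> ('a, 'n, 'z) module_scheme
    \<Rightarrow> ('m \<Rightarrow> 'n) set" where
  "module_hom R M N =
     {f \<in> carrier M \<rightarrow> carrier N.
        (\<forall>x\<in>carrier M. \<forall>y\<in>carrier M. f (x \<oplus>\<^bsub>M\<^esub> y) = f x \<oplus>\<^bsub>N\<^esub> f y) \<and>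
        (\<forall>a\<in>carrier R. \<forall>x\<in>carrier M. f (a \<odot>\<^bsub>M\<^esub> x) = a \<odot>\<^bsub>N\<^esub> f x)}"

(* The lifting property against surjections g : N \<rightarrow> L. HOL cannot quantify over the types of
   N and L, so they are fixed large enough that the canonical surjection from the free module
   on the elements of M (finitely supported functions 'm \<Rightarrow> 'a) onto M is an instance. Lifting
   along that one map makes M a direct summand of a free module, and hence gives the lifting
   property against modules over arbitrary types. *)
definition projective_module ::
  "('a, 'r) ring_scheme \<Rightarrow> ('a, 'm, 'z) module_scheme \<Rightarrow> bool" where
  "projective_module R M \<longleftrightarrow>
     module R M \<and>
     (\<forall>(N :: ('a, 'm \<Rightarrow> 'a) module) (L :: ('a, 'm) module) g f.
        module R N \<and> module R L \<and>
        g \<in> module_hom R N L \<and> g ` carrier N = carrier L \<and> f \<in> module_hom R M L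
        \<longrightarrow> (\<exists>h \<in> module_hom R M N. \<forall>x\<in>carrier M. g (h x) = f x))"

definition annihilator ::
  "('a, 'r) ring_scheme \<Rightarrow> ('a, 'm, 'z) module_scheme \<Rightarrow> 'a set" where
  "annihilator R M = {a \<in> carrier R. \<forall>x\<in>carrier M. a \<odot>\<^bsub>M\<^esub> x = \<zero>\<^bsub>M\<^esub>}"

definition faithful_module ::
  "('a, 'r) ring_scheme \<Rightarrow> ('a, 'm, 'z) module_scheme \<Rightarrow> bool" where
  "faithful_module R M \<longleftrightarrow> annihilator R M = {\<zero>\<^bsub>R\<^esub>}"

definition ideal_smult ::
  "('a, 'r) ring_scheme \<Rightarrow> 'a set \<Rightarrow> ('a, 'm, 'z) module_scheme \<Rightarrow> 'm set" where
  "ideal_smult R J M = submodule_gen R M {a \<odot>\<^bsub>M\<^esub> x | a x. a \<in> J \<and> x \<in> carrier M}"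

definition colon ::
  "('a, 'r) ring_scheme \<Rightarrow> ('a, 'm, 'z) module_scheme \<Rightarrow> 'm set \<Rightarrow> 'm set \<Rightarrow> 'a set" where
  "colon R M A B = {x \<in> carrier R. \<forall>b\<in>B. x \<odot>\<^bsub>M\<^esub> b \<in> A}"

definition self_module :: "('a, 'r) ring_scheme \<Rightarrow> ('a, 'a) module" where
  "self_module R =
     \<lparr>carrier = carrier R, monoid.mult = (\<otimes>\<^bsub>R\<^esub>), one = \<one>\<^bsub>R\<^esub>,
      ring.zero = \<zero>\<^bsub>R\<^esub>, ring.add = (\<oplus>\<^bsub>R\<^esub>), smult = (\<otimes>\<^bsub>R\<^esub>)\<rparr>"

(* Powers of ideals are powers in the library's semiring of ideals, where the product is the
   ideal product and the unit is the carrier of R. *)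
abbreviation ideal_pow :: "('a, 'r) ring_scheme \<Rightarrow> 'a set \<Rightarrow> nat \<Rightarrow> 'a set" where
  "ideal_pow R I k \<equiv> I [^]\<^bsub>ideals_set R\<^esub> k"

definition ratliff_rush_module ::
  "('a, 'r) ring_scheme \<Rightarrow> 'a set \<Rightarrow> ('a, 'm, 'z) module_scheme \<Rightarrow> 'a set" where
  "ratliff_rush_module R I M =
     (\<Union>k\<in>{1..}. colon R M (ideal_smult R (ideal_pow R I (k + 1)) M)
                            (ideal_smult R (ideal_pow R I k) M))"

definition ratliff_rush_closure :: "('a, 'r) ring_scheme \<Rightarrow> 'a set \<Rightarrow> 'a set" where
  "ratliff_rush_closure R I =
     (\<Union>k\<in>{1..}. colon R (self_module R) (ideal_pow R I (k + 1)) (ideal_pow R I k))"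

lemma self_module: "cring R \<Longrightarrow> module R (self_module R)"
proof -
  assume "cring R"
  then interpret cring R .
  have "abelian_group (self_module R)"
  proof (rule abelian_groupI)
    fix x assume "x \<in> carrier (self_module R)"
    then show "\<exists>y\<in>carrier (self_module R).
        y \<oplus>\<^bsub>self_module R\<^esub> x = \<zero>\<^bsub>self_module R\<^esub>"
      by (intro bexI[of _ "\<ominus>\<^bsub>R\<^esub> x"]) (auto simp: self_module_def l_neg)
  qed (auto simp: self_module_def a_ac)
  then show ?thesis
    by (intro moduleI) (auto simp: self_module_def cring_axioms l_distr r_distr m_assoc)
qed

lemma (in cring) ideal_ideal_pow: "ideal I R \<Longrightarrow> ideal (ideal_pow R I k) R"
proof -
  assume I: "ideal I R"
  interpret S: semiring "ideals_set R" by (rule ideals_set_is_semiring)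
  show ?thesis
    using S.nat_pow_closed[of I k] I by (simp add: ideals_set_def)
qed

lemma (in cring) ideal_smult_self:
  assumes "ideal J R" shows "ideal_smult R J (self_module R) = J"
proof -
  interpret S: module R "self_module R" by (rule self_module) (rule cring_axioms)
  interpret J: ideal J R by fact
  have sub: "submodule J R (self_module R)"
  proof (rule S.submoduleI)
    fix a assume a: "a \<in> J"
    have "\<ominus>\<^bsub>self_module R\<^esub> a = \<ominus> a"
      by (simp add: a_inv_def m_inv_def self_module_def)
    then show "\<ominus>\<^bsub>self_module R\<^esub> a \<in> J" using a by simp
  qed (auto simp: self_module_def J.a_Hcarr J.I_l_closed)
  show ?thesis
  proof
    show "ideal_smult R J (self_module R) \<subseteq> J"
      unfolding ideal_smult_def submodule_gen_def
      by (rule Inter_lower) (use sub in \<open>auto simp: self_module_def J.I_r_closed\<close>)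
    have "a \<in> H" if "a \<in> J" "{a \<odot>\<^bsub>self_module R\<^esub> x | a x. a \<in> J \<and> x \<in> carrier (self_module R)} \<subseteq> H"
      for a H
    proof -
      have "a \<otimes> \<one> \<in> H" using that by (fastforce simp: self_module_def)
      then show ?thesis using that J.a_Hcarr by simp
    qed
    then show "J \<subseteq> ideal_smult R J (self_module R)"
      unfolding ideal_smult_def submodule_gen_def by blast
  qed
qed

lemma ratliff_rush_module_self:
  assumes "cring R" "ideal I R"
  shows "ratliff_rush_module R I (self_module R) = ratliff_rush_closure R I"
proof -
  interpret cring R by fact
  show ?thesis
    unfolding ratliff_rush_module_def ratliff_rush_closure_def
    by (simp only: ideal_smult_self[OF ideal_ideal_pow[OF assms(2)]])
qed

(* A finitely generated projective M need not be faithful, and then r(I,M) can exceed the closure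
   of I: for R = Z, I = 2Z, M = 0 it is all of Z. Hence the theorem assumes M faithful. *)
lemma annihilator_subset_ratliff_rush_module:
  assumes "module R M" "ideal I R"
  shows "annihilator R M \<subseteq> ratliff_rush_module R I M"
proof
  interpret module R M by fact
  fix a assume a: "a \<in> annihilator R M"
  have car: "ideal_smult R (ideal_pow R I 1) M \<subseteq> carrier M"
    unfolding ideal_smult_def submodule_gen_def
    using ideal.Icarr[OF ideal_ideal_pow[OF assms(2), of 1]]
    by (intro Inter_lower) (auto intro!: carrier_is_submodule smult_closed simp del: One_nat_def)
  have "\<zero>\<^bsub>M\<^esub> \<in> ideal_smult R (ideal_pow R I (1 + 1)) M"
    unfolding ideal_smult_def submodule_gen_def
    using subgroup.one_closed[OF submodule.axioms(1)] by fastforce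
  then show "a \<in> ratliff_rush_module R I M"
    unfolding ratliff_rush_module_def colon_def
    using a car by (intro UN_I[of 1]) (auto simp: annihilator_def subset_iff)
qed

end

theory Submission
  imports Defs
begin

text \<open>
  The two unions agree term by term, because \<open>(JM : KM) = (J : K)\<close> for all ideals \<open>J\<close> and \<open>K\<close>.
  One inclusion is immediate. For the other, suppose \<open>r\<close> carries \<open>KM\<close> into \<open>JM\<close>. A linear form
  \<open>f : M \<rightarrow> R\<close> maps \<open>JM\<close> into \<open>J\<close>, so \<open>r a f(m) = f(r a m)\<close> lies in \<open>J\<close> for every \<open>a\<close> in \<open>K\<close> and
  every \<open>m\<close> in \<open>M\<close>. Hence \<open>r a\<close> multiplies the trace ideal \<open>T\<close>, which is generated by the values
  of all linear forms on \<open>M\<close>, into \<open>J\<close>; and \<open>r a \<in> J\<close> follows once \<open>1 \<in> T\<close>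
  (\<open>colon_ideal_smult_subset_colon\<close>).

  That \<open>1 \<in> T\<close> (\<open>projective_faithful_trace\<close>) is where the hypotheses on \<open>M\<close> enter. Lifting the
  identity of \<open>M\<close> along the surjection from a free module on finitely many generators \<open>x\<close> yields
  linear forms \<open>f\<^sub>x\<close> with \<open>m = \<Sum> f\<^sub>x(m) x\<close> for all \<open>m\<close> (\<open>projective_dual_basis\<close>), so \<open>M = TM\<close>.
  By Nakayama's lemma some \<open>s\<close> congruent to 1 modulo \<open>T\<close> annihilates \<open>M\<close> (\<open>nakayama\<close>), and \<open>s = 0\<close>
  because \<open>M\<close> is faithful.
\<close>


section \<open>Generated submodules\<close>

context module
begin

lemma submodule_criterion:
  assumes "H \<subseteq> carrier M" "\<zero>\<^bsub>M\<^esub> \<in> H"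
    and "\<And>x y. x \<in> H \<Longrightarrow> y \<in> H \<Longrightarrow> x \<oplus>\<^bsub>M\<^esub> y \<in> H"
    and smult: "\<And>a x. a \<in> carrier R \<Longrightarrow> x \<in> H \<Longrightarrow> a \<odot>\<^bsub>M\<^esub> x \<in> H"
  shows "submodule H R M"
proof (rule submoduleI)
  fix x assume x: "x \<in> H"
  have "\<ominus>\<^bsub>M\<^esub> x = (\<ominus> \<one>) \<odot>\<^bsub>M\<^esub> x"
    using x assms(1) by (simp add: smult_l_minus subset_iff)
  then show "\<ominus>\<^bsub>M\<^esub> x \<in> H" using smult[of "\<ominus> \<one>" x] x by simp
qed (use assms in auto)

lemma submodule_zero_closed: "submodule H R M \<Longrightarrow> \<zero>\<^bsub>M\<^esub> \<in> H"
  using subgroup.one_closed[OF submodule.axioms(1)] by fastforce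

lemma submodule_gen_minimal:
  "submodule H R M \<Longrightarrow> S \<subseteq> H \<Longrightarrow> submodule_gen R M S \<subseteq> H"
  unfolding submodule_gen_def by blast

lemma submodule_gen_incl: "S \<subseteq> submodule_gen R M S"
  unfolding submodule_gen_def by blast

lemma submodule_gen_submodule:
  assumes "S \<subseteq> carrier M"
  shows "submodule (submodule_gen R M S) R M"
proof (rule submodule_criterion)
  show "submodule_gen R M S \<subseteq> carrier M"
    using submodule_gen_minimal[OF carrier_is_submodule] assms .
qed (auto simp: submodule_gen_def submodule_zero_closed submoduleE(5) submoduleE(4))

lemma submodule_finsum_closed:
  assumes "submodule H R M" "finite A" "\<And>i. i \<in> A \<Longrightarrow> f i \<in> H"
  shows "(\<Oplus>\<^bsub>M\<^esub>i\<in>A. f i) \<in> H"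
  using assms(2,3)
proof (induction A rule: finite_induct)
  case empty
  show ?case using submodule_zero_closed[OF assms(1)] by simp
next
  case (insert i A)
  have "f j \<in> carrier M" if "j \<in> insert i A" for j
    using insert.prems that submoduleE(1)[OF assms(1)] by blast
  with insert show ?case
    by (auto simp: Pi_def submoduleE(5)[OF assms(1)])
qed

text \<open>
  With \<open>T = R\<close> these sets bound the submodule generated by \<open>x\<close> together with generators of \<open>N\<close>;
  with a proper ideal \<open>T\<close> they bound the multiple of that submodule by \<open>T\<close>.
\<close>
lemma submodule_cyclic_sum:
  assumes T: "ideal T R" and x: "x \<in> carrier M" and N: "submodule N R M"
  shows "submodule {t \<odot>\<^bsub>M\<^esub> x \<oplus>\<^bsub>M\<^esub> n | t n. t \<in> T \<and> n \<in> N} R M" (is "submodule ?H R M")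
proof (rule submodule_criterion)
  interpret T: ideal T R by fact
  note NM = subsetD[OF submoduleE(1)[OF N]]
  show "?H \<subseteq> carrier M" using T.Icarr NM x by auto
  have "\<zero> \<odot>\<^bsub>M\<^esub> x \<oplus>\<^bsub>M\<^esub> \<zero>\<^bsub>M\<^esub> \<in> ?H"
    using submodule_zero_closed[OF N] T.zero_closed by blast
  then show "\<zero>\<^bsub>M\<^esub> \<in> ?H" using x by simp
next
  interpret T: ideal T R by fact
  note NM = subsetD[OF submoduleE(1)[OF N]]
  fix y z assume "y \<in> ?H" "z \<in> ?H"
  then obtain t n t' n' where *: "t \<in> T" "n \<in> N" "t' \<in> T" "n' \<in> N"
    "y = t \<odot>\<^bsub>M\<^esub> x \<oplus>\<^bsub>M\<^esub> n" "z = t' \<odot>\<^bsub>M\<^esub> x \<oplus>\<^bsub>M\<^esub> n'" by auto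
  have "y \<oplus>\<^bsub>M\<^esub> z = (t \<oplus> t') \<odot>\<^bsub>M\<^esub> x \<oplus>\<^bsub>M\<^esub> (n \<oplus>\<^bsub>M\<^esub> n')"
    using * x NM T.Icarr by (simp add: smult_l_distr M.a_ac)
  moreover have "t \<oplus> t' \<in> T" "n \<oplus>\<^bsub>M\<^esub> n' \<in> N"
    using * T.a_closed submoduleE(5)[OF N] by auto
  ultimately show "y \<oplus>\<^bsub>M\<^esub> z \<in> ?H" by blast
next
  interpret T: ideal T R by fact
  note NM = subsetD[OF submoduleE(1)[OF N]]
  fix a y assume a: "a \<in> carrier R" and "y \<in> ?H"
  then obtain t n where *: "t \<in> T" "n \<in> N" "y = t \<odot>\<^bsub>M\<^esub> x \<oplus>\<^bsub>M\<^esub> n" by auto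
  have "a \<odot>\<^bsub>M\<^esub> y = (a \<otimes> t) \<odot>\<^bsub>M\<^esub> x \<oplus>\<^bsub>M\<^esub> a \<odot>\<^bsub>M\<^esub> n"
    using * a x NM T.Icarr by (simp add: smult_r_distr smult_assoc1)
  moreover have "a \<otimes> t \<in> T" "a \<odot>\<^bsub>M\<^esub> n \<in> N"
    using * a T.I_l_closed submoduleE(4)[OF N] by auto
  ultimately show "a \<odot>\<^bsub>M\<^esub> y \<in> ?H" by blast
qed

lemma submodule_smult_preimage:
  assumes "submodule H R M" "a \<in> carrier R"
  shows "submodule {m \<in> carrier M. a \<odot>\<^bsub>M\<^esub> m \<in> H} R M"
proof (rule submodule_criterion)
  fix b x assume b: "b \<in> carrier R" and "x \<in> {m \<in> carrier M. a \<odot>\<^bsub>M\<^esub> m \<in> H}"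
  then have x: "x \<in> carrier M" "a \<odot>\<^bsub>M\<^esub> x \<in> H" by auto
  have "a \<odot>\<^bsub>M\<^esub> (b \<odot>\<^bsub>M\<^esub> x) = b \<odot>\<^bsub>M\<^esub> (a \<odot>\<^bsub>M\<^esub> x)"
    using assms(2) b x by (metis R.m_comm smult_assoc1)
  with x b show "b \<odot>\<^bsub>M\<^esub> x \<in> {m \<in> carrier M. a \<odot>\<^bsub>M\<^esub> m \<in> H}"
    using submoduleE(4)[OF assms(1)] by auto
qed (use assms in \<open>auto simp: submodule_zero_closed smult_r_distr submoduleE(5)\<close>)

lemma ideal_smult_minimal:
  assumes "submodule H R M" "\<And>a x. a \<in> J \<Longrightarrow> x \<in> carrier M \<Longrightarrow> a \<odot>\<^bsub>M\<^esub> x \<in> H"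
  shows "ideal_smult R J M \<subseteq> H"
  unfolding ideal_smult_def using assms by (intro submodule_gen_minimal) auto

lemma ideal_smult_incl:
  "a \<in> J \<Longrightarrow> x \<in> carrier M \<Longrightarrow> a \<odot>\<^bsub>M\<^esub> x \<in> ideal_smult R J M"
  unfolding ideal_smult_def by (rule subsetD[OF submodule_gen_incl]) blast

lemma submodule_ideal_smult:
  assumes "J \<subseteq> carrier R"
  shows "submodule (ideal_smult R J M) R M"
  unfolding ideal_smult_def using assms by (intro submodule_gen_submodule) auto


section \<open>Nakayama's lemma\<close>

text \<open>
  One generator \<open>x\<close> is removed at a time, in the style of an elimination without determinants.
  From \<open>s M \<subseteq> R x + N\<close> and \<open>M = T M\<close> one gets \<open>s M \<subseteq> T x + N\<close>. Applied to \<open>x\<close> itself this gives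
  \<open>s x = t x + n\<close> with \<open>t \<in> T\<close>, so \<open>u = s - t\<close> is still congruent to 1 modulo \<open>T\<close> and satisfies
  \<open>u x \<in> N\<close>. Therefore \<open>u s M \<subseteq> R (u x) + N = N\<close>.
\<close>
lemma nakayama_step:
  assumes T: "ideal T R" and TM: "carrier M \<subseteq> ideal_smult R T M"
    and x: "x \<in> carrier M" and N: "submodule N R M"
    and s: "s \<in> carrier R" "\<one> \<ominus> s \<in> T"
    and sM: "\<And>m. m \<in> carrier M \<Longrightarrow> \<exists>r\<in>carrier R. \<exists>n\<in>N. s \<odot>\<^bsub>M\<^esub> m = r \<odot>\<^bsub>M\<^esub> x \<oplus>\<^bsub>M\<^esub> n"
  shows "\<exists>s'\<in>carrier R. \<one> \<ominus> s' \<in> T \<and> (\<forall>m\<in>carrier M. s' \<odot>\<^bsub>M\<^esub> m \<in> N)"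
proof -
  interpret T: ideal T R by fact
  note NM = subsetD[OF submoduleE(1)[OF N]]
  let ?H = "{t \<odot>\<^bsub>M\<^esub> x \<oplus>\<^bsub>M\<^esub> n | t n. t \<in> T \<and> n \<in> N}"
  have "ideal_smult R T M \<subseteq> {m \<in> carrier M. s \<odot>\<^bsub>M\<^esub> m \<in> ?H}"
  proof (rule ideal_smult_minimal)
    show "submodule {m \<in> carrier M. s \<odot>\<^bsub>M\<^esub> m \<in> ?H} R M"
      by (intro submodule_smult_preimage submodule_cyclic_sum T x N s)
    fix t m assume t: "t \<in> T" and m: "m \<in> carrier M"
    obtain r n where r: "r \<in> carrier R" "n \<in> N" "s \<odot>\<^bsub>M\<^esub> m = r \<odot>\<^bsub>M\<^esub> x \<oplus>\<^bsub>M\<^esub> n"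
      using sM[OF m] by auto
    have tR: "t \<in> carrier R" using t T.Icarr by blast
    have "s \<odot>\<^bsub>M\<^esub> (t \<odot>\<^bsub>M\<^esub> m) = t \<odot>\<^bsub>M\<^esub> (s \<odot>\<^bsub>M\<^esub> m)"
      using s tR m by (metis R.m_comm smult_assoc1)
    also have "\<dots> = (t \<otimes> r) \<odot>\<^bsub>M\<^esub> x \<oplus>\<^bsub>M\<^esub> t \<odot>\<^bsub>M\<^esub> n"
      using r tR x NM by (simp add: smult_r_distr smult_assoc1)
    finally show "t \<odot>\<^bsub>M\<^esub> m \<in> {m \<in> carrier M. s \<odot>\<^bsub>M\<^esub> m \<in> ?H}"
      using t tR r m T.I_r_closed submoduleE(4)[OF N] by blast
  qed
  then obtain t n where t: "t \<in> T" "n \<in> N" "s \<odot>\<^bsub>M\<^esub> x = t \<odot>\<^bsub>M\<^esub> x \<oplus>\<^bsub>M\<^esub> n"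
    using TM x by blast
  have tR: "t \<in> carrier R" using t T.Icarr by blast
  define u where "u = s \<ominus> t"
  have u: "u \<in> carrier R" using s tR by (simp add: u_def)
  have "\<one> \<ominus> u = (\<one> \<ominus> s) \<oplus> t"
    using s(1) tR unfolding u_def by algebra
  then have uT: "\<one> \<ominus> u \<in> T" using s t T.a_closed by simp
  have "u \<odot>\<^bsub>M\<^esub> x = n"
    using s t tR x NM[OF t(2)]
    by (simp add: u_def R.minus_eq smult_l_distr smult_l_minus M.r_neg M.r_neg1 M.a_ac)
  show ?thesis
  proof (intro bexI[of _ "u \<otimes> s"] conjI ballI)
    have "\<one> \<ominus> u \<otimes> s = (\<one> \<ominus> u) \<oplus> u \<otimes> (\<one> \<ominus> s)"
      using s(1) u by algebra
    then show "\<one> \<ominus> u \<otimes> s \<in> T"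
      using s(2) u uT T.a_closed T.I_l_closed by simp
    show "u \<otimes> s \<in> carrier R" using s u by simp
    fix m assume m: "m \<in> carrier M"
    obtain r k where r: "r \<in> carrier R" "k \<in> N" "s \<odot>\<^bsub>M\<^esub> m = r \<odot>\<^bsub>M\<^esub> x \<oplus>\<^bsub>M\<^esub> k"
      using sM[OF m] by auto
    have "(u \<otimes> s) \<odot>\<^bsub>M\<^esub> m = u \<odot>\<^bsub>M\<^esub> (r \<odot>\<^bsub>M\<^esub> x) \<oplus>\<^bsub>M\<^esub> u \<odot>\<^bsub>M\<^esub> k"
      using s u r x m NM by (simp add: smult_assoc1 smult_r_distr)
    also have "u \<odot>\<^bsub>M\<^esub> (r \<odot>\<^bsub>M\<^esub> x) = r \<odot>\<^bsub>M\<^esub> n"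
      using u r x \<open>u \<odot>\<^bsub>M\<^esub> x = n\<close> by (metis R.m_comm smult_assoc1)
    finally show "(u \<otimes> s) \<odot>\<^bsub>M\<^esub> m \<in> N"
      using u r t submoduleE(4,5)[OF N] by simp
  qed
qed

text \<open>
  The previous lemma is applied to each generator in turn, from \<open>s = 1\<close> and the full set of
  generators down to the zero submodule.
\<close>
lemma nakayama:
  assumes T: "ideal T R" and TM: "carrier M \<subseteq> ideal_smult R T M"
    and fg: "fin_gen_module R M"
  shows "\<exists>s\<in>carrier R. \<one> \<ominus> s \<in> T \<and> s \<in> annihilator R M"
proof -
  interpret T: ideal T R by fact
  obtain S where S: "finite S" "S \<subseteq> carrier M" "submodule_gen R M S = carrier M"
    using fg unfolding fin_gen_module_def by auto
  have peel: "\<exists>s\<in>carrier R. \<one> \<ominus> s \<in> T \<and> (\<forall>m\<in>carrier M. s \<odot>\<^bsub>M\<^esub> m = \<zero>\<^bsub>M\<^esub>)"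
    if "finite A" "A \<subseteq> carrier M" "s \<in> carrier R" "\<one> \<ominus> s \<in> T"
      "\<forall>m\<in>carrier M. s \<odot>\<^bsub>M\<^esub> m \<in> submodule_gen R M A" for A s
    using that
  proof (induction A arbitrary: s rule: finite_induct)
    case empty
    have "submodule {\<zero>\<^bsub>M\<^esub>} R M" by (rule submodule_criterion) auto
    then have "submodule_gen R M {} \<subseteq> {\<zero>\<^bsub>M\<^esub>}" by (rule submodule_gen_minimal) simp
    with empty show ?case by blast
  next
    case (insert x A)
    let ?N = "submodule_gen R M A"
    have x: "x \<in> carrier M" and N: "submodule ?N R M"
      using insert.prems by (auto intro: submodule_gen_submodule)
    let ?H = "{r \<odot>\<^bsub>M\<^esub> x \<oplus>\<^bsub>M\<^esub> n | r n. r \<in> carrier R \<and> n \<in> ?N}"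
    have "insert x A \<subseteq> ?H"
    proof
      fix y assume "y \<in> insert x A"
      moreover have "x = \<one> \<odot>\<^bsub>M\<^esub> x \<oplus>\<^bsub>M\<^esub> \<zero>\<^bsub>M\<^esub>" using x by simp
      then have "x \<in> ?H" using submodule_zero_closed[OF N] by blast
      moreover have "y \<in> ?H" if "y \<in> A"
      proof -
        have "y = \<zero> \<odot>\<^bsub>M\<^esub> x \<oplus>\<^bsub>M\<^esub> y" using x that insert.prems(1) by auto
        then show ?thesis using submodule_gen_incl that by blast
      qed
      ultimately show "y \<in> ?H" by blast
    qed
    then have "submodule_gen R M (insert x A) \<subseteq> ?H"
      by (intro submodule_gen_minimal submodule_cyclic_sum R.oneideal x N)
    then have "\<exists>r\<in>carrier R. \<exists>n\<in>?N. s \<odot>\<^bsub>M\<^esub> m = r \<odot>\<^bsub>M\<^esub> x \<oplus>\<^bsub>M\<^esub> n"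
      if "m \<in> carrier M" for m
      using insert.prems(4) that by blast
    from nakayama_step[OF T TM x N insert.prems(2,3) this]
    show ?case using insert.IH insert.prems(1) by blast
  qed
  have "\<one> \<ominus> \<one> \<in> T" using T.zero_closed by (simp add: R.minus_eq R.r_neg)
  then show ?thesis
    using peel[of S \<one>] S unfolding annihilator_def by auto
qed

end


section \<open>The trace ideal\<close>

definition trace_ideal ::
  "('a, 'r) ring_scheme \<Rightarrow> ('a, 'm, 'z) module_scheme \<Rightarrow> 'a set" where
  "trace_ideal R M =
     genideal R {f m | f m. f \<in> module_hom R M (self_module R) \<and> m \<in> carrier M}"

lemma self_module_simps [simp]:
  "carrier (self_module R) = carrier R"
  "\<zero>\<^bsub>self_module R\<^esub> = \<zero>\<^bsub>R\<^esub>"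
  "x \<oplus>\<^bsub>self_module R\<^esub> y = x \<oplus>\<^bsub>R\<^esub> y"
  "x \<odot>\<^bsub>self_module R\<^esub> y = x \<otimes>\<^bsub>R\<^esub> y"
  by (simp_all add: self_module_def)

text \<open>
  The free module on a finite set \<open>S\<close>. Elements are functions on the whole type, made unique by
  vanishing outside \<open>S\<close>: for \<open>S \<subseteq> M\<close> this is the type of source modules over which the lifting
  property in the definition of a projective module ranges.
\<close>
definition coord_module ::
  "('a, 'r) ring_scheme \<Rightarrow> 'm set \<Rightarrow> ('a, 'm \<Rightarrow> 'a) module" where
  "coord_module R S =
     \<lparr>carrier = {c. (\<forall>x\<in>S. c x \<in> carrier R) \<and> (\<forall>x. x \<notin> S \<longrightarrow> c x = \<zero>\<^bsub>R\<^esub>)},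
      monoid.mult = undefined, one = undefined,
      ring.zero = (\<lambda>_. \<zero>\<^bsub>R\<^esub>), ring.add = (\<lambda>c d x. c x \<oplus>\<^bsub>R\<^esub> d x),
      smult = (\<lambda>a c x. a \<otimes>\<^bsub>R\<^esub> c x)\<rparr>"

lemma coord_module_closed:
  "cring R \<Longrightarrow> c \<in> carrier (coord_module R S) \<Longrightarrow> c x \<in> carrier R"
proof -
  assume "cring R" and c: "c \<in> carrier (coord_module R S)"
  then interpret cring R by simp
  show ?thesis using c by (cases "x \<in> S") (auto simp: coord_module_def)
qed

lemma module_coord_module:
  fixes R (structure)
  assumes "cring R" shows "module R (coord_module R S)"
proof -
  interpret cring R by fact
  note closed = coord_module_closed[OF assms]
  have "abelian_group (coord_module R S)"
  proof (rule abelian_groupI)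
    fix c assume c: "c \<in> carrier (coord_module R S)"
    show "\<exists>d\<in>carrier (coord_module R S). d \<oplus>\<^bsub>coord_module R S\<^esub> c = \<zero>\<^bsub>coord_module R S\<^esub>"
      by (rule bexI[of _ "\<lambda>x. \<ominus>\<^bsub>R\<^esub> c x"]) (use c closed[OF c] in \<open>auto simp: coord_module_def l_neg\<close>)
  next
    fix c d e assume "c \<in> carrier (coord_module R S)" "d \<in> carrier (coord_module R S)"
      "e \<in> carrier (coord_module R S)"
    note cde = this[THEN closed]
    show "c \<oplus>\<^bsub>coord_module R S\<^esub> d \<oplus>\<^bsub>coord_module R S\<^esub> e =
        c \<oplus>\<^bsub>coord_module R S\<^esub> (d \<oplus>\<^bsub>coord_module R S\<^esub> e)"
      using cde by (simp add: coord_module_def a_assoc)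
  next
    fix c d assume "c \<in> carrier (coord_module R S)" "d \<in> carrier (coord_module R S)"
    note cd = this[THEN closed]
    show "c \<oplus>\<^bsub>coord_module R S\<^esub> d = d \<oplus>\<^bsub>coord_module R S\<^esub> c"
      using cd by (simp add: coord_module_def a_comm)
  next
    fix c assume "c \<in> carrier (coord_module R S)"
    from closed[OF this] show "\<zero>\<^bsub>coord_module R S\<^esub> \<oplus>\<^bsub>coord_module R S\<^esub> c = c"
      by (simp add: coord_module_def)
  qed (auto simp: coord_module_def)
  then show ?thesis
  proof (intro moduleI assms)
    fix a b c assume a: "a \<in> carrier R" "b \<in> carrier R" and "c \<in> carrier (coord_module R S)"
    note c = closed[OF this(3)]
    show "(a \<oplus> b) \<odot>\<^bsub>coord_module R S\<^esub> c =
        a \<odot>\<^bsub>coord_module R S\<^esub> c \<oplus>\<^bsub>coord_module R S\<^esub> b \<odot>\<^bsub>coord_module R S\<^esub> c"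
      using a c by (simp add: coord_module_def l_distr)
    show "(a \<otimes> b) \<odot>\<^bsub>coord_module R S\<^esub> c = a \<odot>\<^bsub>coord_module R S\<^esub> (b \<odot>\<^bsub>coord_module R S\<^esub> c)"
      using a c by (simp add: coord_module_def m_assoc)
  next
    fix a c d assume a: "a \<in> carrier R" and "c \<in> carrier (coord_module R S)"
      "d \<in> carrier (coord_module R S)"
    note cd = this(2,3)[THEN closed]
    show "a \<odot>\<^bsub>coord_module R S\<^esub> (c \<oplus>\<^bsub>coord_module R S\<^esub> d) =
        a \<odot>\<^bsub>coord_module R S\<^esub> c \<oplus>\<^bsub>coord_module R S\<^esub> a \<odot>\<^bsub>coord_module R S\<^esub> d"
      using a cd by (simp add: coord_module_def r_distr)
  next
    fix c assume "c \<in> carrier (coord_module R S)"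
    from closed[OF this] show "\<one> \<odot>\<^bsub>coord_module R S\<^esub> c = c"
      by (simp add: coord_module_def)
  qed (auto simp: coord_module_def)
qed

context module
begin

definition lincomb :: "'c set \<Rightarrow> ('c \<Rightarrow> 'a) \<Rightarrow> 'c" where
  "lincomb S c = (\<Oplus>\<^bsub>M\<^esub>x\<in>S. c x \<odot>\<^bsub>M\<^esub> x)"

lemma lincomb_hom:
  assumes S: "finite S" "S \<subseteq> carrier M"
  shows "lincomb S \<in> module_hom R (coord_module R S) M"
  unfolding module_hom_def
proof (intro CollectI conjI ballI Pi_I)
  note closed = coord_module_closed[OF R.is_cring]
  fix c assume c: "c \<in> carrier (coord_module R S)"
  have cM: "(\<lambda>x. c x \<odot>\<^bsub>M\<^esub> x) \<in> S \<rightarrow> carrier M" using closed[OF c] S by auto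
  show "lincomb S c \<in> carrier M"
    unfolding lincomb_def using cM by (rule M.finsum_closed)
  {
    fix d assume d: "d \<in> carrier (coord_module R S)"
    have dM: "(\<lambda>x. d x \<odot>\<^bsub>M\<^esub> x) \<in> S \<rightarrow> carrier M" using closed[OF d] S by auto
    have "lincomb S (c \<oplus>\<^bsub>coord_module R S\<^esub> d) = (\<Oplus>\<^bsub>M\<^esub>x\<in>S. c x \<odot>\<^bsub>M\<^esub> x \<oplus>\<^bsub>M\<^esub> d x \<odot>\<^bsub>M\<^esub> x)"
      unfolding lincomb_def using S closed[OF c] closed[OF d]
      by (intro M.finsum_cong') (auto simp: coord_module_def smult_l_distr subset_iff)
    then show "lincomb S (c \<oplus>\<^bsub>coord_module R S\<^esub> d) = lincomb S c \<oplus>\<^bsub>M\<^esub> lincomb S d"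
      unfolding lincomb_def using M.finsum_addf[OF cM dM] by simp
  }
next
  note closed = coord_module_closed[OF R.is_cring]
  fix a c assume a: "a \<in> carrier R" and c: "c \<in> carrier (coord_module R S)"
  have cM: "(\<lambda>x. c x \<odot>\<^bsub>M\<^esub> x) \<in> S \<rightarrow> carrier M" using closed[OF c] S by auto
  have "lincomb S (a \<odot>\<^bsub>coord_module R S\<^esub> c) = (\<Oplus>\<^bsub>M\<^esub>x\<in>S. a \<odot>\<^bsub>M\<^esub> (c x \<odot>\<^bsub>M\<^esub> x))"
    unfolding lincomb_def using S a closed[OF c]
    by (intro M.finsum_cong') (auto simp: coord_module_def smult_assoc1 subset_iff)
  then show "lincomb S (a \<odot>\<^bsub>coord_module R S\<^esub> c) = a \<odot>\<^bsub>M\<^esub> lincomb S c"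
    unfolding lincomb_def using finsum_smult_ldistr[OF S(1) a cM] by simp
qed

lemma lincomb_surj:
  assumes S: "finite S" "S \<subseteq> carrier M" and gen: "submodule_gen R M S = carrier M"
  shows "lincomb S ` carrier (coord_module R S) = carrier M"
proof
  interpret F: module R "coord_module R S"
    by (rule module_coord_module) (rule R.is_cring)
  note hom = lincomb_hom[OF S, unfolded module_hom_def, simplified]
  show sub: "lincomb S ` carrier (coord_module R S) \<subseteq> carrier M" using hom by blast
  have "submodule (lincomb S ` carrier (coord_module R S)) R M"
  proof (rule submodule_criterion)
    have "lincomb S (\<zero> \<odot>\<^bsub>coord_module R S\<^esub> \<zero>\<^bsub>coord_module R S\<^esub>) =
        \<zero> \<odot>\<^bsub>M\<^esub> lincomb S \<zero>\<^bsub>coord_module R S\<^esub>"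
      using hom by blast
    then have "lincomb S \<zero>\<^bsub>coord_module R S\<^esub> = \<zero>\<^bsub>M\<^esub>"
      using hom F.zero_closed by (simp add: Pi_iff)
    then show "\<zero>\<^bsub>M\<^esub> \<in> lincomb S ` carrier (coord_module R S)"
      using F.zero_closed by (metis imageI)
  next
    fix y z assume "y \<in> lincomb S ` carrier (coord_module R S)"
      "z \<in> lincomb S ` carrier (coord_module R S)"
    then show "y \<oplus>\<^bsub>M\<^esub> z \<in> lincomb S ` carrier (coord_module R S)"
      using hom F.add.m_closed by (smt (verit) imageE imageI)
  next
    fix a z assume "a \<in> carrier R" "z \<in> lincomb S ` carrier (coord_module R S)"
    then show "a \<odot>\<^bsub>M\<^esub> z \<in> lincomb S ` carrier (coord_module R S)"
      using hom F.smult_closed by (smt (verit) imageE imageI)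
  qed (rule sub)
  moreover have "S \<subseteq> lincomb S ` carrier (coord_module R S)"
  proof
    fix x assume x: "x \<in> S"
    let ?c = "\<lambda>y. if y = x then \<one> else \<zero>"
    \<comment> \<open>The sum is oriented as \<open>if x = y\<close> to match the library's rule for a sum with one nonzero
      term.\<close>
    have "lincomb S ?c = (\<Oplus>\<^bsub>M\<^esub>y\<in>S. if x = y then y else \<zero>\<^bsub>M\<^esub>)"
      unfolding lincomb_def using S by (intro M.finsum_cong') auto
    also have "\<dots> = x"
      using M.finsum_singleton[OF x S(1), of "\<lambda>y. y"] S(2) by auto
    finally show "x \<in> lincomb S ` carrier (coord_module R S)"
      using x by (intro image_eqI[of _ _ ?c]) (auto simp: coord_module_def)
  qed
  ultimately show "carrier M \<subseteq> lincomb S ` carrier (coord_module R S)"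
    using submodule_gen_minimal gen by blast
qed

text \<open>
  The dual basis lemma. A section \<open>h\<close> of the surjection \<open>lincomb S\<close> assigns to each \<open>m\<close> a choice of
  coefficients that depends linearly on \<open>m\<close>; the forms \<open>f x\<close> are the coordinates of \<open>h\<close>.
\<close>
lemma projective_dual_basis:
  assumes proj: "projective_module R M" and S: "finite S" "S \<subseteq> carrier M"
    and gen: "submodule_gen R M S = carrier M"
  shows "\<exists>f. (\<forall>x. f x \<in> module_hom R M (self_module R)) \<and>
    (\<forall>m\<in>carrier M. (\<Oplus>\<^bsub>M\<^esub>x\<in>S. f x m \<odot>\<^bsub>M\<^esub> x) = m)"
proof -
  let ?F = "coord_module R S"
  \<comment> \<open>The lifting property is stated for targets that are plain module records, so \<open>M\<close>, whose
    record may carry extra fields, is replaced by a copy.\<close>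
  define L :: "('a, 'c) module" where
    "L = \<lparr>carrier = carrier M, monoid.mult = undefined, one = undefined,
          ring.zero = \<zero>\<^bsub>M\<^esub>, ring.add = (\<oplus>\<^bsub>M\<^esub>), smult = (\<odot>\<^bsub>M\<^esub>)\<rparr>"
  have "abelian_group L"
  proof (rule abelian_groupI)
    fix x assume "x \<in> carrier L"
    then show "\<exists>y\<in>carrier L. y \<oplus>\<^bsub>L\<^esub> x = \<zero>\<^bsub>L\<^esub>"
      by (intro bexI[of _ "\<ominus>\<^bsub>M\<^esub> x"]) (auto simp: L_def M.l_neg)
  qed (auto simp: L_def M.a_ac)
  then have L: "module R L"
    by (intro moduleI R.is_cring)
      (auto simp: L_def smult_l_distr smult_r_distr smult_assoc1)
  have "lincomb S \<in> module_hom R ?F L" "lincomb S ` carrier ?F = carrier L"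
    "(\<lambda>m. m) \<in> module_hom R M L"
    using lincomb_hom[OF S] lincomb_surj[OF S gen] by (simp_all add: L_def module_hom_def)
  then obtain h where h: "h \<in> module_hom R M ?F" and sec: "\<forall>m\<in>carrier M. lincomb S (h m) = m"
    using proj L module_coord_module[OF R.is_cring, of S]
    unfolding projective_module_def by meson
  have hF: "h m \<in> carrier ?F" if "m \<in> carrier M" for m
    using h that by (auto simp: module_hom_def)
  have "(\<lambda>m. h m x) \<in> module_hom R M (self_module R)" for x
    using h coord_module_closed[OF R.is_cring hF]
    by (auto simp: module_hom_def coord_module_def)
  then show ?thesis
    using sec unfolding lincomb_def by (intro exI[of _ "\<lambda>x m. h m x"]) auto
qed

lemma trace_values_subset:
  "{f m | f m. f \<in> module_hom R M (self_module R) \<and> m \<in> carrier M} \<subseteq> carrier R"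
  by (auto simp: module_hom_def)

lemma ideal_trace_ideal: "ideal (trace_ideal R M) R"
  unfolding trace_ideal_def by (rule R.genideal_ideal) (rule trace_values_subset)

lemma trace_ideal_incl:
  "f \<in> module_hom R M (self_module R) \<Longrightarrow> m \<in> carrier M \<Longrightarrow> f m \<in> trace_ideal R M"
  unfolding trace_ideal_def using R.genideal_self[OF trace_values_subset] by blast

lemma projective_trace_smult:
  assumes proj: "projective_module R M" and fg: "fin_gen_module R M"
  shows "carrier M \<subseteq> ideal_smult R (trace_ideal R M) M"
proof
  interpret T: ideal "trace_ideal R M" R by (rule ideal_trace_ideal)
  obtain S where S: "finite S" "S \<subseteq> carrier M" "submodule_gen R M S = carrier M"
    using fg unfolding fin_gen_module_def by auto
  obtain f where f: "\<And>x. f x \<in> module_hom R M (self_module R)"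
    and sum: "\<And>m. m \<in> carrier M \<Longrightarrow> (\<Oplus>\<^bsub>M\<^esub>x\<in>S. f x m \<odot>\<^bsub>M\<^esub> x) = m"
    using projective_dual_basis[OF proj S] by blast
  fix m assume m: "m \<in> carrier M"
  have "(\<Oplus>\<^bsub>M\<^esub>x\<in>S. f x m \<odot>\<^bsub>M\<^esub> x) \<in> ideal_smult R (trace_ideal R M) M"
    using S(1,2) m f T.Icarr
    by (intro submodule_finsum_closed submodule_ideal_smult ideal_smult_incl trace_ideal_incl) auto
  then show "m \<in> ideal_smult R (trace_ideal R M) M" using sum[OF m] by simp
qed

text \<open>
  Equivalently, the trace ideal is all of \<open>R\<close>, that is, \<open>M\<close> is a generator of the category of
  \<open>R\<close>-modules.
\<close>
lemma projective_faithful_trace: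
  assumes "projective_module R M" "fin_gen_module R M" "faithful_module R M"
  shows "\<one> \<in> trace_ideal R M"
proof -
  obtain s where "\<one> \<ominus> s \<in> trace_ideal R M" "s \<in> annihilator R M"
    using nakayama[OF ideal_trace_ideal projective_trace_smult assms(2)] assms(1,2) by blast
  moreover from this have "s = \<zero>" using assms(3) by (simp add: faithful_module_def)
  ultimately show ?thesis by (simp add: R.minus_eq)
qed


section \<open>Colons of ideals and of the submodules they generate\<close>

lemma linear_form_ideal_smult:
  assumes f: "f \<in> module_hom R M (self_module R)" and J: "ideal J R"
    and m: "m \<in> ideal_smult R J M"
  shows "f m \<in> J"
proof -
  interpret J: ideal J R by fact
  have add: "\<And>x y. x \<in> carrier M \<Longrightarrow> y \<in> carrier M \<Longrightarrow> f (x \<oplus>\<^bsub>M\<^esub> y) = f x \<oplus> f y"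
    and smult: "\<And>a x. a \<in> carrier R \<Longrightarrow> x \<in> carrier M \<Longrightarrow> f (a \<odot>\<^bsub>M\<^esub> x) = a \<otimes> f x"
    and closed: "\<And>x. x \<in> carrier M \<Longrightarrow> f x \<in> carrier R"
    using f by (auto simp: module_hom_def)
  have "f \<zero>\<^bsub>M\<^esub> = \<zero>"
    using smult[of \<zero> "\<zero>\<^bsub>M\<^esub>"] closed[of "\<zero>\<^bsub>M\<^esub>"] by simp
  then have "submodule {x \<in> carrier M. f x \<in> J} R M"
    by (intro submodule_criterion) (auto simp: add smult J.I_l_closed)
  then have "ideal_smult R J M \<subseteq> {x \<in> carrier M. f x \<in> J}"
    by (rule ideal_smult_minimal) (auto simp: smult closed J.Icarr J.I_r_closed)
  with m show ?thesis by blast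
qed

lemma ideal_colon:
  assumes J: "ideal J R" and "b \<in> carrier R"
  shows "ideal {t \<in> carrier R. b \<otimes> t \<in> J} R"
proof -
  interpret J: ideal J R by fact
  show ?thesis
  proof (rule idealI)
    show "subgroup {t \<in> carrier R. b \<otimes> t \<in> J} (add_monoid R)"
      using assms(2)
      by (intro R.add.subgroupI) (auto simp: R.r_distr R.r_minus a_inv_def[symmetric])
    fix t a assume "t \<in> {t \<in> carrier R. b \<otimes> t \<in> J}" and a: "a \<in> carrier R"
    then have t: "t \<in> carrier R" "b \<otimes> t \<in> J" by auto
    have "b \<otimes> (t \<otimes> a) = (b \<otimes> t) \<otimes> a" using assms(2) t a by (simp add: R.m_assoc)
    then show "t \<otimes> a \<in> {t \<in> carrier R. b \<otimes> t \<in> J}"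
      using t a J.I_r_closed by simp
    then show "a \<otimes> t \<in> {t \<in> carrier R. b \<otimes> t \<in> J}"
      using t a by (simp add: R.m_comm)
  qed (rule R.ring_axioms)
qed

lemma colon_subset_colon_ideal_smult:
  assumes J: "ideal J R" and K: "ideal K R"
  shows "colon R (self_module R) J K \<subseteq> colon R M (ideal_smult R J M) (ideal_smult R K M)"
proof
  interpret J: ideal J R by fact
  interpret K: ideal K R by fact
  fix r assume "r \<in> colon R (self_module R) J K"
  then have r: "r \<in> carrier R" and rK: "\<And>a. a \<in> K \<Longrightarrow> r \<otimes> a \<in> J"
    by (auto simp: colon_def)
  have "ideal_smult R K M \<subseteq> {m \<in> carrier M. r \<odot>\<^bsub>M\<^esub> m \<in> ideal_smult R J M}"
  proof (rule ideal_smult_minimal)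
    show "submodule {m \<in> carrier M. r \<odot>\<^bsub>M\<^esub> m \<in> ideal_smult R J M} R M"
      using r J.Icarr by (intro submodule_smult_preimage submodule_ideal_smult) auto
    fix a m assume a: "a \<in> K" and m: "m \<in> carrier M"
    have "r \<odot>\<^bsub>M\<^esub> (a \<odot>\<^bsub>M\<^esub> m) = (r \<otimes> a) \<odot>\<^bsub>M\<^esub> m"
      using r m K.Icarr[OF a] by (simp add: smult_assoc1)
    with ideal_smult_incl[OF rK[OF a] m] K.Icarr[OF a] m
    show "a \<odot>\<^bsub>M\<^esub> m \<in> {m \<in> carrier M. r \<odot>\<^bsub>M\<^esub> m \<in> ideal_smult R J M}" by simp
  qed
  with r show "r \<in> colon R M (ideal_smult R J M) (ideal_smult R K M)"
    by (auto simp: colon_def)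
qed

text \<open>
  The elements \<open>t\<close> with \<open>r a t \<in> J\<close> form an ideal. It contains the values of all linear forms,
  hence the trace ideal, hence 1.
\<close>
lemma colon_ideal_smult_subset_colon:
  assumes J: "ideal J R" and K: "ideal K R" and trace: "\<one> \<in> trace_ideal R M"
  shows "colon R M (ideal_smult R J M) (ideal_smult R K M) \<subseteq> colon R (self_module R) J K"
proof
  interpret J: ideal J R by fact
  interpret K: ideal K R by fact
  fix r assume "r \<in> colon R M (ideal_smult R J M) (ideal_smult R K M)"
  then have r: "r \<in> carrier R"
    and rK: "\<And>m. m \<in> ideal_smult R K M \<Longrightarrow> r \<odot>\<^bsub>M\<^esub> m \<in> ideal_smult R J M"
    by (auto simp: colon_def)
  have "r \<otimes> a \<in> J" if a: "a \<in> K" for a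
  proof -
    have ra: "r \<otimes> a \<in> carrier R" using r K.Icarr[OF a] by simp
    have "(r \<otimes> a) \<otimes> f m \<in> J"
      if f: "f \<in> module_hom R M (self_module R)" and m: "m \<in> carrier M" for f m
    proof -
      have "(r \<otimes> a) \<odot>\<^bsub>M\<^esub> m \<in> ideal_smult R J M"
        using rK[OF ideal_smult_incl[OF a m]] r K.Icarr[OF a] m by (simp add: smult_assoc1)
      moreover have "f ((r \<otimes> a) \<odot>\<^bsub>M\<^esub> m) = (r \<otimes> a) \<otimes> f m"
        using f ra m by (simp add: module_hom_def)
      ultimately show ?thesis using linear_form_ideal_smult[OF f J] by metis
    qed
    then have "trace_ideal R M \<subseteq> {t \<in> carrier R. (r \<otimes> a) \<otimes> t \<in> J}"
      unfolding trace_ideal_def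
      by (intro R.genideal_minimal ideal_colon J ra) (auto simp: module_hom_def)
    with trace have "(r \<otimes> a) \<otimes> \<one> \<in> J" by blast
    then show ?thesis using ra by simp
  qed
  with r show "r \<in> colon R (self_module R) J K" by (simp add: colon_def)
qed

end

theorem corollary1p6:
  fixes R :: "('a, 'r) ring_scheme" and M :: "('a, 'm, 'z) module_scheme" and I :: "'a set"
  assumes "cring R" and "noetherian_ring R"
    and "module R M" and "fin_gen_module R M" and "projective_module R M"
    and "faithful_module R M"
    and "ideal I R"
  shows "ratliff_rush_module R I M = ratliff_rush_closure R I"
proof -
  interpret module R M by fact
  note trace = projective_faithful_trace[OF assms(5,4,6)]
  have "colon R M (ideal_smult R (ideal_pow R I (k + 1)) M) (ideal_smult R (ideal_pow R I k) M) =
      colon R (self_module R) (ideal_pow R I (k + 1)) (ideal_pow R I k)" for k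
    using colon_subset_colon_ideal_smult colon_ideal_smult_subset_colon[OF _ _ trace]
      R.ideal_ideal_pow[OF assms(7)] by (intro equalityI) blast+
  then show ?thesis
    unfolding ratliff_rush_module_def ratliff_rush_closure_def by simp
qed

end
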